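(* For every integer $a\geq 2$, the minimal system of generators of the numerical semigroup $S(a)$ is $\mathrm{msg}(S(a)) = \{ l_a,\ l_a+l_0,\ l_a+l_1,\ \ldots,\ l_a+l_{a-1}\}$.
   Context: $\mathbb{N}=\{0,1,2,\ldots\}$. The Lucas series $\{l_n\}_{n\in\mathbb{N}}$ is defined by $l_0=2$, $l_1=1$, $l_{n+2}=l_{n+1}+l_n$. For $X\subseteq\mathbb{N}$ non-empty, $\langle X\rangle$ is the submonoid of $(\mathbb{N},+)$ generated by $X$ (all finite sums of elements of $X$ with non-negative integer coefficients). A numerical semigroup is a submonoid $S$ of $(\mathbb{N},+)$ with $\mathbb{N}\setminus S$ finite. Each numerical semigroup $S$ has a unique minimal system of generators $\mathrm{msg}(S)$: the set $X$ with $\langle X\rangle=S$ and $\langle Y\rangle\neq S$ for every $Y\subsetneq X$. For $a\in\mathbb{N}$, $S(a)=\langle \{l_a\}\cup\{l_a+l_n \mid n\in\mathbb{N}\}\rangle$, which is a numerical semigroup. *)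

theory Defs
  imports Main
begin

fun lucas :: "nat \<Rightarrow> nat" where
  "lucas 0 = 2"
| "lucas (Suc 0) = 1"
| "lucas (Suc (Suc n)) = lucas (Suc n) + lucas n"

definition monoid_span :: "nat set \<Rightarrow> nat set" where
  "monoid_span X = {\<Sum>x\<in>F. c x * x | F c. finite F \<and> F \<subseteq> X}"

definition nat_submonoid :: "nat set \<Rightarrow> bool" where
  "nat_submonoid S \<longleftrightarrow> 0 \<in> S \<and> (\<forall>x\<in>S. \<forall>y\<in>S. x + y \<in> S)"

definition numerical_semigroup :: "nat set \<Rightarrow> bool" where
  "numerical_semigroup S \<longleftrightarrow> nat_submonoid S \<and> finite (UNIV - S)"

definition minimal_generating_set :: "nat set \<Rightarrow> nat set \<Rightarrow> bool" where
  "minimal_generating_set S X \<longleftrightarrow> monoid_span X = S \<and> (\<forall>Y. Y \<subset> X \<longrightarrow> monoid_span Y \<noteq> S)"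

(* The description is meaningful for every numerical semigroup: see ex1_minimal_generating_set. *)
definition msg :: "nat set \<Rightarrow> nat set" where
  "msg S = (THE X. minimal_generating_set S X)"

definition lucas_semigroup :: "nat \<Rightarrow> nat set" where
  "lucas_semigroup a = monoid_span ({lucas a} \<union> {lucas a + lucas n | n. True})"


lemma monoid_span_superset: "x \<in> X \<Longrightarrow> x \<in> monoid_span X"
  unfolding monoid_span_def
  by (rule CollectI, rule exI[of _ "{x}"], rule exI[of _ "\<lambda>_. 1"]) simp

lemma nat_submonoid_monoid_span: "nat_submonoid (monoid_span X)"
  unfolding nat_submonoid_def
proof (intro conjI ballI)
  show "0 \<in> monoid_span X"
    unfolding monoid_span_def by (rule CollectI, rule exI[of _ "{}"]) simp
next
  fix x y assume "x \<in> monoid_span X" "y \<in> monoid_span X"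
  then obtain F c G d where F: "finite F" "F \<subseteq> X" "x = (\<Sum>z\<in>F. c z * z)"
    and G: "finite G" "G \<subseteq> X" "y = (\<Sum>z\<in>G. d z * z)"
    unfolding monoid_span_def by blast
  define e where "e z = (if z \<in> F then c z else 0) + (if z \<in> G then d z else 0)" for z
  have "x = (\<Sum>z\<in>F \<union> G. (if z \<in> F then c z else 0) * z)"
    unfolding F(3) using F(1) G(1) by (intro sum.mono_neutral_cong_left) auto
  moreover have "y = (\<Sum>z\<in>F \<union> G. (if z \<in> G then d z else 0) * z)"
    unfolding G(3) using F(1) G(1) by (intro sum.mono_neutral_cong_left) auto
  ultimately have "x + y = (\<Sum>z\<in>F \<union> G. e z * z)"
    unfolding e_def by (simp add: sum.distrib algebra_simps)
  then show "x + y \<in> monoid_span X"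
    unfolding monoid_span_def using F(1,2) G(1,2) by blast
qed

lemma nat_submonoid_mult:
  assumes "nat_submonoid S" "x \<in> S" shows "k * x \<in> S"
  using assms by (induction k) (auto simp: nat_submonoid_def)

lemma monoid_span_least:
  assumes "nat_submonoid S" "X \<subseteq> S" shows "monoid_span X \<subseteq> S"
proof -
  have "(\<Sum>x\<in>F. c x * x) \<in> S" if "finite F" "F \<subseteq> X" for F c
    using that
  proof (induction F rule: finite_induct)
    case empty
    then show ?case using assms(1) by (simp add: nat_submonoid_def)
  next
    case (insert x F)
    then have "c x * x \<in> S" using assms nat_submonoid_mult by auto
    with insert assms(1) show ?case by (simp add: nat_submonoid_def)
  qed
  then show ?thesis unfolding monoid_span_def by blast
qed

lemma ex1_minimal_generating_set:
  assumes "numerical_semigroup S"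
  shows "\<exists>!X. minimal_generating_set S X"
proof -
  have S: "nat_submonoid S" using assms by (simp add: numerical_semigroup_def)
  define A where "A = {s \<in> S. s \<noteq> 0 \<and> (\<forall>x\<in>S. \<forall>y\<in>S. s = x + y \<longrightarrow> x = 0 \<or> y = 0)}"
  have "s \<in> monoid_span A" if "s \<in> S" for s
    using that
  proof (induction s rule: less_induct)
    case (less s)
    note span = nat_submonoid_monoid_span[of A, unfolded nat_submonoid_def]
    consider "s = 0" | "s \<in> A"
      | x y where "x \<in> S" "y \<in> S" "s = x + y" "x \<noteq> 0" "y \<noteq> 0"
      using less.prems unfolding A_def by blast
    then show ?case
    proof cases
      case 3
      then have "x \<in> monoid_span A" "y \<in> monoid_span A" using less.IH by auto
      then show ?thesis using span 3 by blast
    qed (use span monoid_span_superset in auto)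
  qed
  moreover have "monoid_span A \<subseteq> S" by (rule monoid_span_least[OF S]) (auto simp: A_def)
  ultimately have A: "monoid_span A = S" by blast
  have least: "A \<subseteq> X" if X: "monoid_span X = S" for X
  proof
    fix s assume s: "s \<in> A"
    then have "s \<in> monoid_span X" using X by (simp add: A_def)
    then obtain F c where F: "finite F" "F \<subseteq> X" "s = (\<Sum>x\<in>F. c x * x)"
      unfolding monoid_span_def by blast
    have "s \<noteq> 0" using s by (simp add: A_def)
    then obtain x where x: "x \<in> F" "c x * x \<noteq> 0" using F(3) by (meson sum.neutral)
    define r where "r = (c x - 1) * x + (\<Sum>z\<in>F - {x}. c z * z)"
    have "s = c x * x + (\<Sum>z\<in>F - {x}. c z * z)"
      unfolding F(3) by (rule sum.remove[OF F(1) x(1)])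
    also have "c x * x = x + (c x - 1) * x" using x(2) by (cases "c x") auto
    finally have sr: "s = x + r" by (simp add: r_def)
    have xS: "x \<in> S" using x(1) F(2) X monoid_span_superset by blast
    have "(\<Sum>z\<in>F - {x}. c z * z) \<in> S"
      unfolding X[symmetric] monoid_span_def using F(1,2) by blast
    then have "r \<in> S"
      using S nat_submonoid_mult[OF S xS] unfolding r_def by (auto simp: nat_submonoid_def)
    then have "r = 0" using s xS sr x(2) unfolding A_def by auto
    then show "s \<in> X" using sr x(1) F(2) by auto
  qed
  show ?thesis
  proof (rule ex1I[of _ A])
    show "minimal_generating_set S A"
      unfolding minimal_generating_set_def using A least by blast
  next
    fix X assume "minimal_generating_set S X"
    then show "X = A"
      unfolding minimal_generating_set_def using A least by blast
  qed
qed

lemma numerical_semigroup_lucas_semigroup: "numerical_semigroup (lucas_semigroup a)"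
proof -
  let ?S = "lucas_semigroup a" and ?k = "lucas a"
  have S: "nat_submonoid ?S"
    unfolding lucas_semigroup_def by (rule nat_submonoid_monoid_span)
  have pos: "?k > 0" by (induction a rule: lucas.induct) auto
  have k: "?k \<in> ?S" unfolding lucas_semigroup_def by (rule monoid_span_superset) simp
  have "?k + lucas (Suc 0) \<in> ?S"
    unfolding lucas_semigroup_def by (rule monoid_span_superset) blast
  then have k1: "?k + 1 \<in> ?S" by simp
  have "N \<in> ?S" if "N \<ge> ?k * ?k" for N
  proof -
    define q r where "q = N div ?k" and "r = N mod ?k"
    have "r \<le> q"
      using pos that div_le_mono[OF that, of ?k] mod_less_divisor[OF pos, of N]
      by (simp add: q_def r_def)
    have "N = q * ?k + r" by (simp add: q_def r_def)
    also have "\<dots> = (q - r) * ?k + r * (?k + 1)"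
      using \<open>r \<le> q\<close> by (metis add.assoc add_mult_distrib le_add_diff_inverse2
          distrib_left mult.right_neutral)
    finally have "N = (q - r) * ?k + r * (?k + 1)" .
    then show ?thesis
      using S nat_submonoid_mult[OF S k] nat_submonoid_mult[OF S k1]
      by (metis nat_submonoid_def)
  qed
  then have "UNIV - ?S \<subseteq> {..< ?k * ?k}" by (auto simp: not_le[symmetric])
  then have "finite (UNIV - ?S)" by (rule finite_subset) simp
  then show ?thesis using S by (simp add: numerical_semigroup_def)
qed

end

theory Submission
  imports Defs
begin

text \<open>
  For \<open>m \<ge> 0\<close> one has \<open>l\<^bsub>a+m\<^esub> = p l\<^sub>a + q l\<^bsub>a-1\<^esub>\<close> with \<open>p \<ge> q\<close> (consecutive Fibonacci numbers),
  so \<open>l\<^sub>a + l\<^bsub>a+m\<^esub>\<close> is the combination \<open>(1 + p - q) l\<^sub>a + q (l\<^sub>a + l\<^bsub>a-1\<^esub>)\<close> of the first generators.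
  These all lie in the interval from \<open>l\<^sub>a\<close> to \<open>2 l\<^sub>a - 1\<close>, so none of them is a sum of two or
  more others.
\<close>

lemma lucas_pos: "lucas n > 0"
  by (induction n rule: lucas.induct) auto

text \<open>The shift avoids the one descent of the series, from \<open>lucas 0 = 2\<close> to
  \<open>lucas 1 = 1\<close>.\<close>

lemma strict_mono_lucas_Suc: "strict_mono (\<lambda>n. lucas (Suc n))"
  by (simp add: strict_mono_Suc_iff lucas_pos)

lemma lucas_less:
  assumes "n < a" "a \<ge> 2" shows "lucas n < lucas a"
proof (cases n)
  case 0
  \<comment> \<open>Index 0 lies outside the shifted monotonicity; it is compared through
    \<open>lucas 2 = 3\<close>.\<close>
  have "lucas 2 \<le> lucas a"
    using monoD[OF strict_mono_mono[OF strict_mono_lucas_Suc], of 1 "a - 1"] assms(2)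
    by (simp add: numeral_2_eq_2)
  then show ?thesis using 0 by (simp add: numeral_2_eq_2)
next
  case (Suc k)
  then show ?thesis
    using strict_monoD[OF strict_mono_lucas_Suc, of k "a - 1"] assms(1) by simp
qed

text \<open>The coefficient pairs start as (1,0) and (1,1) and add up as the Lucas numbers do, which
  preserves \<open>q \<le> p\<close>. The inequality is carried along so that \<open>p - q\<close>
  can serve as a coefficient.\<close>

lemma lucas_combination:
  "\<exists>p q. q \<le> p \<and> lucas (Suc b + m) = p * lucas (Suc b) + q * lucas b"
proof (induction m rule: lucas.induct)
  case 1
  show ?case by (rule exI[of _ 1], rule exI[of _ 0]) simp
next
  case 2
  show ?case by (rule exI[of _ 1], rule exI[of _ 1]) simp
next
  case (3 m)
  obtain p q where p: "q \<le> p" "lucas (Suc b + Suc m) = p * lucas (Suc b) + q * lucas b"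
    using "3.IH"(1) by blast
  obtain r s where r: "s \<le> r" "lucas (Suc b + m) = r * lucas (Suc b) + s * lucas b"
    using "3.IH"(2) by blast
  have "lucas (Suc b + Suc (Suc m)) = lucas (Suc b + Suc m) + lucas (Suc b + m)" by simp
  also have "\<dots> = (p + r) * lucas (Suc b) + (q + s) * lucas b"
    unfolding p(2) r(2) by (simp add: distrib_right)
  finally show ?case using p(1) r(1) add_mono by blast
qed

lemma monoid_span_eqI:
  assumes "X \<subseteq> Z" "Z \<subseteq> monoid_span X" shows "monoid_span Z = monoid_span X"
proof
  show "monoid_span Z \<subseteq> monoid_span X"
    by (rule monoid_span_least[OF nat_submonoid_monoid_span assms(2)])
  show "monoid_span X \<subseteq> monoid_span Z"
    by (rule monoid_span_least[OF nat_submonoid_monoid_span])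
      (use assms(1) monoid_span_superset in blast)
qed

text \<open>A sum of two nonzero elements is at least \<open>2 * k\<close>, so 0, \<open>Y\<close>
  and all numbers from \<open>2 * k\<close> on form a submonoid. It contains the span of
  \<open>Y\<close> but misses any \<open>x\<close> in \<open>X - Y\<close>.\<close>

lemma minimal_generating_set_interval:
  fixes k :: nat
  assumes "k > 0" "X \<subseteq> {k..<2 * k}"
  shows "minimal_generating_set (monoid_span X) X"
  unfolding minimal_generating_set_def
proof (intro conjI allI impI notI)
  fix Y assume Y: "Y \<subset> X" "monoid_span Y = monoid_span X"
  then obtain x where x: "x \<in> X" "x \<notin> Y" by blast
  have "u + v \<ge> 2 * k" if "u \<in> Y \<union> {2 * k..}" "v \<in> Y \<union> {2 * k..}" for u v
  proof -
    have "Y \<union> {2 * k..} \<subseteq> {k..}" using Y(1) assms(2) by auto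
    then have "u \<ge> k" "v \<ge> k" using that by auto
    then show ?thesis by simp
  qed
  then have "nat_submonoid ({0} \<union> Y \<union> {2 * k..})"
    unfolding nat_submonoid_def by auto
  then have "monoid_span Y \<subseteq> {0} \<union> Y \<union> {2 * k..}"
    by (rule monoid_span_least) blast
  moreover have "x \<in> monoid_span Y" using x(1) Y(2) monoid_span_superset by simp
  moreover have "k \<le> x" "x < 2 * k" using x(1) assms(2) by auto
  ultimately show False using x(2) assms(1) by auto
qed simp

lemma msg_eqI:
  assumes "numerical_semigroup S" "minimal_generating_set S X" shows "msg S = X"
  unfolding msg_def using ex1_minimal_generating_set[OF assms(1)] assms(2)
  by (rule the1_equality)

lemma lucas_semigroup_eq:
  assumes "a \<ge> 1"
  shows "lucas_semigroup a = monoid_span ({lucas a} \<union> {lucas a + lucas n | n. n \<le> a - 1})"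
    (is "_ = monoid_span ?X")
  unfolding lucas_semigroup_def
proof (rule monoid_span_eqI)
  obtain b where b: "a = Suc b" using assms by (cases a) auto
  have S: "nat_submonoid (monoid_span ?X)" by (rule nat_submonoid_monoid_span)
  \<comment> \<open>These two generators, with \<open>b = a - 1\<close>, already produce every
    \<open>lucas a + lucas n\<close> with \<open>n \<ge> a\<close>.\<close>
  have k: "lucas a \<in> monoid_span ?X" and kb: "lucas a + lucas b \<in> monoid_span ?X"
    using b by (auto intro!: monoid_span_superset)
  have "lucas a + lucas n \<in> monoid_span ?X" for n
  proof (cases "n \<le> a - 1")
    case True
    then show ?thesis by (intro monoid_span_superset) blast
  next
    case False
    then obtain m where "n = a + m" by (metis b diff_Suc_1 less_eq_Suc_le not_less le_iff_add)
    then obtain p q where pq: "q \<le> p" "lucas n = p * lucas a + q * lucas b"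
      using lucas_combination[of b m] b by blast
    then obtain d where "p = q + d" by (auto simp: le_iff_add)
    with pq have "lucas a + lucas n = (1 + d) * lucas a + q * (lucas a + lucas b)"
      by (simp add: algebra_simps)
    moreover have "(1 + d) * lucas a \<in> monoid_span ?X" "q * (lucas a + lucas b) \<in> monoid_span ?X"
      using nat_submonoid_mult[OF S] k kb by blast+
    ultimately show ?thesis using S unfolding nat_submonoid_def by (simp only:)
  qed
  then show "{lucas a} \<union> {lucas a + lucas n | n. True} \<subseteq> monoid_span ?X"
    using k by blast
qed blast

theorem proposition3p2:
  fixes a :: nat
  assumes "a \<ge> 2"
  shows "msg (lucas_semigroup a) = {lucas a} \<union> {lucas a + lucas n | n. n \<le> a - 1}"
proof (rule msg_eqI[OF numerical_semigroup_lucas_semigroup])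
  let ?X = "{lucas a} \<union> {lucas a + lucas n | n. n \<le> a - 1}"
  \<comment> \<open>This puts each generator below \<open>2 * lucas a\<close>. For
    \<open>a = 1\<close> it would fail at \<open>n = 0\<close>.\<close>
  have "lucas n < lucas a" if "n \<le> a - 1" for n
    using that assms by (intro lucas_less) auto
  then have "?X \<subseteq> {lucas a..<2 * lucas a}" using lucas_pos[of a] by auto
  then show "minimal_generating_set (lucas_semigroup a) ?X"
    unfolding lucas_semigroup_eq[OF order_trans[OF one_le_numeral assms]]
    by (rule minimal_generating_set_interval[OF lucas_pos])
qed

end
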